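(* Let $n\ge 1$ and $0\le q\le n$. Let $M=(E,\Gamma)$ be the matroid where $E=[n]=\{1,\dots,n\}$ and $\Gamma$ (the collection of independent sets) is the set of all subsets of $[n]$ of size less than or equal to $q$. Then there exists a universal cycle for the set of binary encodings of the elements of $\Gamma$.
   Context: A subset $B\subseteq[n]$ is encoded by the binary string $a_1\cdots a_n$ with $a_i=1$ if $i\in B$ and $a_i=0$ otherwise. A universal cycle for a finite set $A'$ of words of length $n$ over a finite alphabet is a cyclic sequence $c_0c_1\cdots c_{L-1}$ of letters, with $L=|A'|$, such that every word of $A'$ occurs exactly once among the $L$ windows $c_ic_{i+1}\cdots c_{i+n-1}$, $0\le i<L$ (indices modulo $L$, so a window may wrap around the cycle repeatedly). *)

theory Defs
  imports Main
begin

locale matroid =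
  fixes E :: "'a set" and \<Gamma> :: "'a set set"
  assumes finite_ground: "finite E"
    and indep_subset: "B \<in> \<Gamma> \<Longrightarrow> B \<subseteq> E"
    and indep_empty: "{} \<in> \<Gamma>"
    and indep_hereditary: "\<lbrakk>B \<in> \<Gamma>; A \<subseteq> B\<rbrakk> \<Longrightarrow> A \<in> \<Gamma>"
    and indep_augment: "\<lbrakk>A \<in> \<Gamma>; B \<in> \<Gamma>; card A < card B\<rbrakk> \<Longrightarrow> \<exists>x \<in> B - A. insert x A \<in> \<Gamma>"

lemma matroid_uniform:
  assumes "finite E"
  shows "matroid E {B. B \<subseteq> E \<and> card B \<le> q}"
proof
  show "finite E" by (fact assms)
next
  fix B assume "B \<in> {B. B \<subseteq> E \<and> card B \<le> q}"
  then show "B \<subseteq> E" by simp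
next
  show "{} \<in> {B. B \<subseteq> E \<and> card B \<le> q}" by simp
next
  fix A B assume B: "B \<in> {B. B \<subseteq> E \<and> card B \<le> q}" and "A \<subseteq> B"
  moreover have "card A \<le> card B"
    using B \<open>A \<subseteq> B\<close> assms by (auto intro: card_mono finite_subset)
  ultimately show "A \<in> {B. B \<subseteq> E \<and> card B \<le> q}" by auto
next
  fix A B
  assume A: "A \<in> {B. B \<subseteq> E \<and> card B \<le> q}" and B: "B \<in> {B. B \<subseteq> E \<and> card B \<le> q}"
    and less: "card A < card B"
  have "finite A" using A assms by (auto intro: finite_subset)
  then have "\<not> B \<subseteq> A" using less card_mono leD by blast
  then obtain x where x: "x \<in> B - A" by blast
  have "insert x A \<in> {B. B \<subseteq> E \<and> card B \<le> q}"
    using A B x less \<open>finite A\<close> by auto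
  then show "\<exists>x \<in> B - A. insert x A \<in> {B. B \<subseteq> E \<and> card B \<le> q}" using x by blast
qed

definition encode :: "nat \<Rightarrow> nat set \<Rightarrow> nat list" where
  "encode n B = map (\<lambda>i. if i \<in> B then 1 else 0) [1..<Suc n]"

definition window :: "nat \<Rightarrow> 'a list \<Rightarrow> nat \<Rightarrow> 'a list" where
  "window n c i = map (\<lambda>j. c ! ((i + j) mod length c)) [0..<n]"

(* A cyclic sequence is represented by the list of its letters from an arbitrary starting
   point; since indices are reduced modulo the length, the length may be smaller than n. *)
definition universal_cycle :: "'a set \<Rightarrow> nat \<Rightarrow> 'a list set \<Rightarrow> 'a list \<Rightarrow> bool" where
  "universal_cycle \<Sigma> n A c \<longleftrightarrow>
     finite \<Sigma> \<and> A \<subseteq> {w. set w \<subseteq> \<Sigma> \<and> length w = n} \<and>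
     set c \<subseteq> \<Sigma> \<and> length c = card A \<and>
     (\<forall>w \<in> A. \<exists>!i. i < length c \<and> window n c i = w)"

end

theory Submission
  imports Defs
begin

text \<open>
  Reading the words of a universal cycle in order of occurrence turns it into a cyclic
  enumeration of \<open>A\<close> in which each word overlaps its successor in all but the first letter of
  the former and the last letter of the latter; conversely, the heads of such an enumeration form
  a universal cycle (\<open>universal_cycle_of_overlap_cycle\<close>).  So it suffices to arrange the
  words of \<open>A\<close> in one overlap cycle, and this is done by joining cycles.

  The rotations of a single word form an overlap cycle.  Moreover, two disjoint overlap cycles
  that end in words \<open>x # v\<close> and \<open>y # v\<close> with a common tail can simply be
  concatenated: each of the two words overlaps every word that the other one overlaps.

  The words of weight at most \<open>q\<close> are closed under rotation and under resetting the
  first letter to \<open>0\<close>, and these two closure properties are enough, over any alphabet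
  with a distinguished letter \<open>z\<close> in the place of \<open>0\<close>.  Unless such a set
  contains only the constant word \<open>z \<dots> z\<close>, choose among its words of largest weight one, \<open>x # v\<close>, that starts with a letter
  \<open>x \<noteq> z\<close>, and remove all its rotations.  By maximality of the weight, the remaining set
  inherits both closure properties, so it has an overlap cycle by induction; it contains
  \<open>z # v\<close>, and there the rotations of \<open>x # v\<close> are joined
  (\<open>overlap_cycle_exists\<close>).
\<close>

section \<open>Overlap cycles and universal cycles\<close>

definition overlaps :: "'a list \<Rightarrow> 'a list \<Rightarrow> bool" where
  "overlaps u w \<longleftrightarrow> tl u = butlast w"

definition overlap_cycle :: "'a list list \<Rightarrow> bool" where
  "overlap_cycle ws \<longleftrightarrow>
     ws \<noteq> [] \<and> distinct ws \<and> successively overlaps ws \<and> overlaps (last ws) (hd ws)"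

lemma overlap_cycle_nth:
  assumes "overlap_cycle ws" "i < length ws"
  shows "overlaps (ws ! i) (ws ! (Suc i mod length ws))"
proof (cases "Suc i < length ws")
  case True
  with assms show ?thesis
    by (simp add: overlap_cycle_def successively_conv_nth)
next
  case False
  with assms(2) have "Suc i = length ws" by simp
  then show ?thesis
    using assms(1) by (auto simp: overlap_cycle_def last_conv_nth hd_conv_nth simp flip: \<open>Suc i = length ws\<close>)
qed

text \<open>
  Every step along an overlap cycle moves each letter one place to the left, so the letter at
  position \<open>k\<close> of a word becomes the head \<open>k\<close> steps later.
\<close>

lemma overlap_cycle_nth_nth:
  assumes cyc: "overlap_cycle ws" and len: "\<And>w. w \<in> set ws \<Longrightarrow> length w = n"
    and i: "i < length ws" and "j + k < n"
  shows "ws ! ((i + k) mod length ws) ! j = ws ! i ! (j + k)"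
  using \<open>j + k < n\<close>
proof (induction k arbitrary: j)
  case 0
  then show ?case using i by simp
next
  case (Suc k)
  let ?L = "length ws"
  let ?u = "ws ! ((i + k) mod ?L)" and ?w = "ws ! ((i + Suc k) mod ?L)"
  have L: "0 < ?L" using i by linarith
  have lu: "length ?u = n" and lw: "length ?w = n"
    using len L by simp_all
  have "overlaps ?u ?w"
    using overlap_cycle_nth[OF cyc, of "(i + k) mod ?L"] L by (simp add: mod_Suc_eq)
  then have "?w ! j = tl ?u ! j"
    using Suc.prems lw by (simp add: overlaps_def nth_butlast)
  also have "\<dots> = ?u ! Suc j"
    using Suc.prems lu by (simp add: nth_tl)
  also have "\<dots> = ws ! i ! (Suc j + k)"
    using Suc.IH[of "Suc j"] Suc.prems by simp
  finally show ?case by simp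
qed

lemma universal_cycle_of_overlap_cycle:
  assumes cyc: "overlap_cycle ws"
    and len: "\<And>w. w \<in> set ws \<Longrightarrow> length w = n" and "0 < n"
    and \<Sigma>: "finite \<Sigma>" "\<And>w. w \<in> set ws \<Longrightarrow> set w \<subseteq> \<Sigma>"
  shows "universal_cycle \<Sigma> n (set ws) (map hd ws)"
proof -
  let ?c = "map hd ws"
  have nonempty: "w \<noteq> []" if "w \<in> set ws" for w
    using len[OF that] \<open>0 < n\<close> by auto
  have dist: "distinct ws" using cyc by (simp add: overlap_cycle_def)
  have win: "window n ?c i = ws ! i" if i: "i < length ws" for i
  proof (rule nth_equalityI)
    show "length (window n ?c i) = length (ws ! i)"
      using len[of "ws ! i"] i by (simp add: window_def)
  next
    fix j assume "j < length (window n ?c i)"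
    then have j: "j < n" by (simp add: window_def)
    have m: "(i + j) mod length ws < length ws" using i by (intro mod_less_divisor) linarith
    have "window n ?c i ! j = hd (ws ! ((i + j) mod length ws))"
      using j m by (simp add: window_def)
    also have "\<dots> = ws ! ((i + j) mod length ws) ! 0"
      using nonempty[of "ws ! ((i + j) mod length ws)"] m by (simp add: hd_conv_nth)
    also have "\<dots> = ws ! i ! j"
      using overlap_cycle_nth_nth[OF cyc len i, where j = 0 and k = j] j by simp
    finally show "window n ?c i ! j = ws ! i ! j" .
  qed
  have "\<exists>!i. i < length ?c \<and> window n ?c i = w" if "w \<in> set ws" for w
  proof -
    from that obtain i where "i < length ws" "ws ! i = w" by (auto simp: in_set_conv_nth)
    then show ?thesis
      using dist by (intro ex1I[of _ i]) (auto simp: win nth_eq_iff_index_eq)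
  qed
  moreover have "set ?c \<subseteq> \<Sigma>"
    using \<Sigma>(2) nonempty hd_in_set by fastforce
  moreover have "set ws \<subseteq> {w. set w \<subseteq> \<Sigma> \<and> length w = n}"
    using \<Sigma>(2) len by blast
  ultimately show ?thesis
    unfolding universal_cycle_def using \<Sigma>(1) distinct_card[OF dist]
    by (intro conjI ballI) simp_all
qed

section \<open>Rotation classes\<close>

definition rotations :: "'a list \<Rightarrow> 'a list set" where
  "rotations w = range (\<lambda>k. rotate k w)"

lemma self_in_rotations: "w \<in> rotations w"
  unfolding rotations_def by (rule range_eqI[of _ _ 0]) simp

text \<open>Rotation is invertible on words of a given length by further rotation, so the complement of a
  rotation class is closed under rotation as well.\<close>

lemma rotations_rotate1_cancel:
  assumes "rotate1 u \<in> rotations w"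
  shows "u \<in> rotations w"
proof -
  from assms obtain k where k: "rotate1 u = rotate k w"
    by (auto simp: rotations_def)
  have "u = rotate (length u - 1) (rotate1 u)"
  proof (cases "u = []")
    case False
    then show ?thesis by (cases u) (simp_all add: rotate_append)
  qed simp
  also have "\<dots> = rotate (length u - 1 + k) w"
    by (simp add: k rotate_rotate)
  finally show ?thesis by (auto simp: rotations_def)
qed

text \<open>
  Listing the rotations from \<open>rotate1 w\<close> onwards puts \<open>w\<close> itself last, where another
  cycle can be joined.  Periodic words have fewer rotations than letters, so the list stops at the
  least period.
\<close>

lemma rotations_overlap_cycle:
  assumes "w \<noteq> []"
  obtains rs where "overlap_cycle rs" "set rs = rotations w" "last rs = w"
proof -
  define p where "p = (LEAST p. 0 < p \<and> rotate p w = w)"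
  have "0 < length w \<and> rotate (length w) w = w" using assms by simp
  then have p: "0 < p" "rotate p w = w" unfolding p_def by (metis (mono_tags, lifting) LeastI)+
  have least: "rotate k w \<noteq> w" if "0 < k" "k < p" for k
    using not_less_Least[of k "\<lambda>p. 0 < p \<and> rotate p w = w"] that by (auto simp: p_def)
  define rs where "rs = map (\<lambda>k. rotate k w) [1..<Suc p]"
  have rs: "rs \<noteq> []" "hd rs = rotate1 w" "last rs = w"
    using p by (simp_all add: rs_def hd_map last_map hd_append del: upt_Suc)
  have ov: "overlaps u (rotate1 u)" for u :: "'a list"
    by (cases u) (simp_all add: overlaps_def)
  have "successively overlaps rs"
    by (auto simp: rs_def successively_conv_nth ov simp del: upt_Suc)
  moreover have "overlaps (last rs) (hd rs)"
    by (simp add: rs ov)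
  moreover have "distinct rs"
  proof -
    have neq: "rotate k w \<noteq> rotate l w" if "0 < k" "k < l" "l \<le> p" for k l
    proof
      assume "rotate k w = rotate l w"
      \<comment> \<open>Rotating on to \<open>p\<close> turns this coincidence into a period shorter than \<open>p\<close>.\<close>
      then have "rotate (p - l) (rotate k w) = rotate (p - l) (rotate l w)" by simp
      then have "rotate (p - l + k) w = w" using that p by (simp add: rotate_rotate)
      moreover have "0 < p - l + k" "p - l + k < p" using that by linarith+
      ultimately show False using least[of "p - l + k"] by simp
    qed
    have "inj_on (\<lambda>k. rotate k w) {1..<Suc p}"
    proof (rule inj_onI)
      fix k l assume kl: "k \<in> {1..<Suc p}" "l \<in> {1..<Suc p}" "rotate k w = rotate l w"
      then show "k = l" using neq[of k l] neq[of l k] by (cases k l rule: linorder_cases) auto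
    qed
    then show ?thesis by (simp add: rs_def distinct_map del: upt_Suc)
  qed
  moreover have "set rs = rotations w"
  proof
    show "set rs \<subseteq> rotations w" by (auto simp: rs_def rotations_def)
    show "rotations w \<subseteq> set rs"
    proof
      fix u assume "u \<in> rotations w"
      then obtain k where "u = rotate k w" by (auto simp: rotations_def)
      then have u: "u = rotate (k mod p) w"
        using funpow_mod_eq[where f = rotate1 and x = w and n = p and m = k] p by (simp add: rotate_def)
      show "u \<in> set rs"
      proof (cases "k mod p = 0")
        case True
        then show ?thesis using u rs last_in_set by fastforce
      next
        case False
        then show ?thesis
          using u mod_less_divisor[OF p(1), of k] by (auto simp: rs_def simp del: upt_Suc)
      qed
    qed
  qed
  ultimately show thesis using that[of rs] rs by (auto simp: overlap_cycle_def)
qed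

section \<open>Joining cycles\<close>

lemma overlap_cycle_rotate_to:
  assumes "overlap_cycle ws" "u \<in> set ws"
  obtains ws' where "overlap_cycle ws'" "set ws' = set ws" "last ws' = u"
proof -
  from assms(2) obtain as bs where ws: "ws = as @ u # bs" by (auto simp: in_set_conv_decomp)
  have "overlap_cycle (bs @ as @ [u])"
    using assms(1) unfolding ws overlap_cycle_def
    by (auto simp: successively_append_iff successively_Cons hd_append split: if_splits)
  then show thesis using that[of "bs @ as @ [u]"] by (auto simp: ws)
qed

text \<open>
  Whether a word overlaps another one depends only on its tail, so the last words of the two cycles
  can exchange their successors; this merges the two cycles into one.
\<close>

lemma overlap_cycle_append:
  assumes "overlap_cycle us" "overlap_cycle ws" "set us \<inter> set ws = {}"
    and "tl (last us) = tl (last ws)"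
  shows "overlap_cycle (us @ ws)"
  using assms by (auto simp: overlap_cycle_def successively_append_iff overlaps_def)

definition weight :: "'a \<Rightarrow> 'a list \<Rightarrow> nat" where
  "weight z w = length (filter (\<lambda>x. x \<noteq> z) w)"

lemma weight_rotate1: "weight z (rotate1 w) = weight z w"
  by (cases w) (simp_all add: weight_def)

lemma weight_rotations: "u \<in> rotations w \<Longrightarrow> weight z u = weight z w"
proof -
  have "weight z (rotate k w) = weight z w" for k
    by (induction k) (simp_all add: weight_rotate1)
  then show "u \<in> rotations w \<Longrightarrow> weight z u = weight z w" by (auto simp: rotations_def)
qed

lemma rotations_subset:
  assumes "\<And>w. w \<in> A \<Longrightarrow> rotate1 w \<in> A" "w \<in> A"
  shows "rotations w \<subseteq> A"
proof -
  have "rotate k w \<in> A" for k by (induction k) (simp_all add: assms)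
  then show ?thesis by (auto simp: rotations_def)
qed

text \<open>
  Induction on \<open>A\<close>, removing one rotation class of largest weight.  Resetting a letter other
  than \<open>z\<close> lowers the weight, so it never leads from a remaining word into a class of
  largest weight; this is why the removal preserves the closure properties.
\<close>

theorem overlap_cycle_exists:
  fixes A :: "'a list set"
  assumes "finite A" "A \<noteq> {}" "0 < n" "\<And>w. w \<in> A \<Longrightarrow> length w = n"
    and "\<And>w. w \<in> A \<Longrightarrow> rotate1 w \<in> A"
    and "\<And>x v. x # v \<in> A \<Longrightarrow> z # v \<in> A"
  shows "\<exists>ws. overlap_cycle ws \<and> set ws = A"
  using assms
proof (induction A rule: finite_psubset_induct)
  case (psubset A)
  note rot = psubset.prems(4) and reset = psubset.prems(5)
  have "Max (weight z ` A) \<in> weight z ` A"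
    using psubset.hyps psubset.prems(1) by (intro Max_in) auto
  then obtain m where "m \<in> A" "weight z m = Max (weight z ` A)" by auto
  then have m: "m \<in> A" "\<And>u. u \<in> A \<Longrightarrow> weight z u \<le> weight z m"
    using psubset.hyps by auto
  show ?case
  proof (cases "weight z m = 0")
    case True
    have "u = replicate n z" if "u \<in> A" for u
      using m(2)[OF that] psubset.prems(3)[OF that] True
      by (auto simp: weight_def filter_empty_conv intro!: replicate_eqI)
    then have "A = {replicate n z}" using m(1) by auto
    moreover have "overlap_cycle [replicate n z]"
      by (simp add: overlap_cycle_def overlaps_def butlast_conv_take min_def)
    ultimately show ?thesis by (intro exI[of _ "[replicate n z]"]) simp
  next
    case False
    then obtain x where "x \<in> set m" "x \<noteq> z" by (auto simp: weight_def filter_empty_conv)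
    then obtain as bs where "m = as @ x # bs" by (auto simp: in_set_conv_decomp)
    define v where "v = bs @ as"
    have "x # v \<in> rotations m"
      unfolding rotations_def \<open>m = as @ x # bs\<close> v_def
      by (rule range_eqI[of _ _ "length as"]) (simp add: rotate_append)
    then have xv: "x # v \<in> A" and max: "\<And>u. u \<in> A \<Longrightarrow> weight z u \<le> weight z (x # v)"
      using m rotations_subset[OF rot m(1)] weight_rotations[of "x # v" m z] by auto
    define R where "R = rotations (x # v)"
    have R: "x # v \<in> R" "R \<subseteq> A"
      using rotations_subset[OF rot xv] by (auto simp: R_def self_in_rotations)
    have "weight z (z # v) < weight z (x # v)" using \<open>x \<noteq> z\<close> by (simp add: weight_def)
    then have "z # v \<notin> R" unfolding R_def using weight_rotations by fastforce
    then have zv: "z # v \<in> A - R" using reset[OF xv] by simp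
    have "\<exists>ws. overlap_cycle ws \<and> set ws = A - R"
    proof (rule psubset.IH)
      show "A - R \<subset> A" using R by blast
      show "A - R \<noteq> {}" using zv by blast
      show "0 < n" by fact
      show "length w = n" if "w \<in> A - R" for w using that psubset.prems(3) by blast
      show "rotate1 w \<in> A - R" if "w \<in> A - R" for w
        using that rot rotations_rotate1_cancel unfolding R_def by blast
      show "z # u \<in> A - R" if "y # u \<in> A - R" for y u
      proof (cases "y = z")
        case True
        with that show ?thesis by simp
      next
        case False
        have "z # u \<notin> R"
        proof
          assume "z # u \<in> R"
          then have "weight z (z # u) = weight z (x # v)" unfolding R_def by (rule weight_rotations)
          moreover have "weight z (y # u) \<le> weight z (x # v)" using max that by blast
          ultimately show False using False by (simp add: weight_def)
        qed
        then show ?thesis using that reset by blast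
      qed
    qed
    then obtain ws where "overlap_cycle ws" "set ws = A - R" by blast
    then obtain us where us: "overlap_cycle us" "set us = A - R" "last us = z # v"
      using zv overlap_cycle_rotate_to by metis
    obtain rs where rs: "overlap_cycle rs" "set rs = R" "last rs = x # v"
      unfolding R_def using rotations_overlap_cycle[of "x # v"] by blast
    have "overlap_cycle (us @ rs)"
      using us rs by (intro overlap_cycle_append) auto
    moreover have "set (us @ rs) = A" using us rs R by auto
    ultimately show ?thesis by blast
  qed
qed

section \<open>Encodings of bounded subsets\<close>

lemma weight_encode:
  assumes "B \<subseteq> {1..n}"
  shows "weight 0 (encode n B) = card B"
proof -
  have "weight 0 (encode n B) = length (filter (\<lambda>i. i \<in> B) [1..<Suc n])"
    by (simp add: weight_def encode_def filter_map o_def del: upt_Suc)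
  also have "\<dots> = card (set (filter (\<lambda>i. i \<in> B) [1..<Suc n]))"
    by (rule distinct_card[symmetric]) (simp del: upt_Suc)
  also have "set (filter (\<lambda>i. i \<in> B) [1..<Suc n]) = B"
    using assms by (auto simp del: upt_Suc)
  finally show ?thesis .
qed

lemma encode_image_bounded_subsets:
  "encode n ` {B. B \<subseteq> {1..n} \<and> card B \<le> q} =
     {w. set w \<subseteq> {0, 1} \<and> length w = n \<and> weight 0 w \<le> q}" (is "?L = ?R")
proof
  show "?L \<subseteq> ?R"
    by (auto simp: weight_encode) (auto simp: encode_def)
  show "?R \<subseteq> ?L"
  proof
    fix w assume w: "w \<in> ?R"
    define B where "B = {i \<in> {1..n}. w ! (i - 1) = 1}"
    have "B \<subseteq> {1..n}" by (auto simp: B_def)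
    moreover have "encode n B = w"
    proof (rule nth_equalityI)
      show "length (encode n B) = length w" using w by (simp add: encode_def)
      fix j assume "j < length (encode n B)"
      then have j: "j < n" by (simp add: encode_def del: upt_Suc)
      then have "w ! j \<in> set w" using w by simp
      then have "w ! j \<in> {0, 1}" using w by blast
      then show "encode n B ! j = w ! j"
        using j by (auto simp: encode_def B_def simp del: upt_Suc)
    qed
    ultimately show "w \<in> ?L" using w weight_encode[of B n] by (auto intro!: image_eqI[of _ _ B])
  qed
qed

theorem corollary3:
  fixes n q :: nat and E :: "nat set" and \<Gamma> :: "nat set set"
  assumes "n \<ge> 1" and "0 \<le> q" and "q \<le> n"
    and "matroid E \<Gamma>"
    and "E = {1..n}"
    and "\<Gamma> = {B. B \<subseteq> {1..n} \<and> card B \<le> q}"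
  shows "\<exists>c. universal_cycle {0, 1} n (encode n ` \<Gamma>) c"
proof -
  define A where "A = encode n ` \<Gamma>"
  have A: "A = {w. set w \<subseteq> {0, 1} \<and> length w = n \<and> weight 0 w \<le> q}"
    unfolding A_def assms(6) by (rule encode_image_bounded_subsets)
  have "\<exists>ws. overlap_cycle ws \<and> set ws = A"
  proof (rule overlap_cycle_exists[where n = n and z = 0])
    show "finite A" by (simp add: A_def assms(6))
    have "{} \<in> \<Gamma>" by (simp add: assms(6))
    then show "A \<noteq> {}" by (auto simp: A_def)
    show "0 < n" using assms(1) by simp
    show "length w = n" if "w \<in> A" for w using that by (simp add: A)
    show "rotate1 w \<in> A" if "w \<in> A" for w using that by (simp add: A weight_rotate1)
    show "0 # v \<in> A" if "x # v \<in> A" for x v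
      using that by (auto simp: A weight_def split: if_splits)
  qed
  then obtain ws where ws: "overlap_cycle ws" "set ws = A" by blast
  have "universal_cycle {0, 1} n (set ws) (map hd ws)"
    using assms(1) by (intro universal_cycle_of_overlap_cycle ws(1)) (auto simp: ws(2) A)
  then show ?thesis unfolding ws(2) A_def by blast
qed

end
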